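(* Let $f:\mathbb{R}^n\to\overline{\mathbb{R}}$ be proper, lower semicontinuous and prox-bounded with threshold $\lambda_f\in(0,\infty]$. Then for every $0<\lambda<\lambda_f$, $$P_\lambda f=(\operatorname{Id}+\lambda\,\partial_p^\lambda f)^{-1},$$ where $P_\lambda f$ is the proximal mapping of $f$ with parameter $\lambda$ and $\partial_p^\lambda f$ is the $\lambda$-level proximal subdifferential of $f$. Consequently, for every $0<\lambda<\lambda_f$, the operator $(\operatorname{Id}+\lambda\,\partial_p^\lambda f)^{-1}:\mathbb{R}^n\to 2^{\mathbb{R}^n}$ has full domain (i.e. is nonempty-valued at every point of $\mathbb{R}^n$), is compact-valued, and for every $x\in\mathbb{R}^n$ $$(\operatorname{Id}+\lambda\,\partial_p^\lambda f)^{-1}(x)=\big\{v\in\mathbb{R}^n:\ \exists\, x_k\to x,\ \exists\,\lambda_k\to\lambda\ (\lambda_k>0),\ \exists\, v_k\in(\operatorname{Id}+\lambda_k\,\partial_p^{\lambda_k} f)^{-1}(x_k)\ \text{with } v_k\to v\big\}.$$ Furthermore, $\operatorname{gph}\partial_p^\lambda f=T(\operatorname{gph}P_\lambda f)$, where $$T=\begin{bmatrix}0&\operatorname{Id}\\ \operatorname{Id}/\lambda&-\operatorname{Id}/\lambda\end{bmatrix}:\mathbb{R}^n\times\mathbb{R}^n\to\mathbb{R}^n\times\mathbb{R}^n,\qquad T(x,y)=\big(y,(x-y)/\lambda\big),$$ is an invertible linear transformation.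
   Context: $\mathbb{R}^n$ carries the standard inner product $\langle\cdot,\cdot\rangle$ and norm $\|\cdot\|$; $\overline{\mathbb{R}}=\mathbb{R}\cup\{\pm\infty\}$. A function $f:\mathbb{R}^n\to\overline{\mathbb{R}}$ is proper if $f>-\infty$ everywhere and $\operatorname{dom} f=\{x: f(x)<\infty\}$ is nonempty. A proper lower semicontinuous $f$ is prox-bounded if there is $\lambda>0$ such that $f+\frac{1}{2\lambda}\|\cdot\|^2$ is bounded below; the supremum of all such $\lambda$ is the threshold $\lambda_f$. Proximal mapping: $P_\lambda f(x)=\operatorname{argmin}_{y\in\mathbb{R}^n}\{f(y)+\frac{1}{2\lambda}\|y-x\|^2\}$. Level proximal subdifferential: for $\lambda>0$ and $x\in\operatorname{dom} f$, $u\in\partial_p^\lambda f(x)$ if $$f(y)\ge f(x)+\langle u,y-x\rangle-\frac{1}{2\lambda}\|y-x\|^2\quad\text{for all }y\in\mathbb{R}^n;$$ $\partial_p^\lambda f(x)=\emptyset$ for $x\notin\operatorname{dom} f$. For a set-valued operator $A:\mathbb{R}^n\to 2^{\mathbb{R}^n}$, $\operatorname{gph}A=\{(x,u):u\in A(x)\}$, and $x^*\in(\operatorname{Id}+\lambda A)^{-1}(x)$ means $x\in x^*+\lambda A(x^* )$. *)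

theory Defs
  imports "HOL-Analysis.Analysis"
begin

definition eff_dom :: "('a \<Rightarrow> ereal) \<Rightarrow> 'a set" where
  "eff_dom f = {x. f x < \<infinity>}"

definition proper :: "('a \<Rightarrow> ereal) \<Rightarrow> bool" where
  "proper f \<longleftrightarrow> (\<forall>x. f x > -\<infinity>) \<and> eff_dom f \<noteq> {}"

definition lsc :: "('a::topological_space \<Rightarrow> ereal) \<Rightarrow> bool" where
  "lsc f \<longleftrightarrow> (\<forall>x. f x \<le> Liminf (at x) f)"

definition prox_bounded_with :: "real \<Rightarrow> ('a::real_normed_vector \<Rightarrow> ereal) \<Rightarrow> bool" where
  "prox_bounded_with lam f \<longleftrightarrow>
     (\<exists>c::real. \<forall>x. ereal c \<le> f x + ereal (1 / (2 * lam) * (norm x)\<^sup>2))"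

definition prox_bounded :: "('a::real_normed_vector \<Rightarrow> ereal) \<Rightarrow> bool" where
  "prox_bounded f \<longleftrightarrow> (\<exists>lam>0. prox_bounded_with lam f)"

definition prox_threshold :: "('a::real_normed_vector \<Rightarrow> ereal) \<Rightarrow> ereal" where
  "prox_threshold f = Sup {ereal lam | lam. lam > 0 \<and> prox_bounded_with lam f}"

definition prox :: "real \<Rightarrow> ('a::real_normed_vector \<Rightarrow> ereal) \<Rightarrow> 'a \<Rightarrow> 'a set" where
  "prox lam f x =
     {y. is_arg_min (\<lambda>z. f z + ereal (1 / (2 * lam) * (norm (z - x))\<^sup>2)) (\<lambda>z. z \<in> UNIV) y}"

definition level_prox_subdiff ::
  "real \<Rightarrow> ('a::real_inner \<Rightarrow> ereal) \<Rightarrow> 'a \<Rightarrow> 'a set" where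
  "level_prox_subdiff lam f x =
     (if x \<in> eff_dom f
      then {u. \<forall>y. f y \<ge> f x + ereal (u \<bullet> (y - x)) - ereal (1 / (2 * lam) * (norm (y - x))\<^sup>2)}
      else {})"

definition gph :: "('a \<Rightarrow> 'b set) \<Rightarrow> ('a \<times> 'b) set" where
  "gph A = {(x, u). u \<in> A x}"

definition op_dom :: "('a \<Rightarrow> 'b set) \<Rightarrow> 'a set" where
  "op_dom A = {x. A x \<noteq> {}}"

definition op_inverse :: "('a \<Rightarrow> 'b set) \<Rightarrow> 'b \<Rightarrow> 'a set" where
  "op_inverse A x = {y. x \<in> A y}"

definition id_plus :: "real \<Rightarrow> ('a::real_vector \<Rightarrow> 'a set) \<Rightarrow> 'a \<Rightarrow> 'a set" where
  "id_plus lam A y = {y + lam *\<^sub>R u | u. u \<in> A y}"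

definition level_resolvent :: "real \<Rightarrow> ('a::real_inner \<Rightarrow> ereal) \<Rightarrow> 'a \<Rightarrow> 'a set" where
  "level_resolvent lam f = op_inverse (id_plus lam (level_prox_subdiff lam f))"

text \<open>The block matrix with rows $(0, \mathrm{Id})$ and $(\mathrm{Id}/lam, -\mathrm{Id}/lam)$.\<close>

definition prox_transform :: "real \<Rightarrow> 'a::real_vector \<times> 'a \<Rightarrow> 'a \<times> 'a" where
  "prox_transform lam = (\<lambda>(x, y). (y, (x - y) /\<^sub>R lam))"

end

theory Submission
  imports Defs
begin

text \<open>
  Completing the square gives, for all \<open>x, y, z\<close>,
  \<open>\<parallel>z - x\<parallel>\<^sup>2 = \<parallel>y - x\<parallel>\<^sup>2 - 2 * ((x - y) \<bullet> (z - y)) + \<parallel>z - y\<parallel>\<^sup>2\<close>.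
  Hence the inequality saying that \<open>y\<close> minimises \<open>f + \<parallel>\<cdot> - x\<parallel>\<^sup>2 / (2 lam)\<close> is, term by term, the
  inequality saying that \<open>(x - y) / lam\<close> is a level proximal subgradient of \<open>f\<close> at \<open>y\<close>. This is
  the identity between the proximal mapping and the resolvent (\<open>prox_eq_level_resolvent\<close>), and
  reading it as a change of coordinates on pairs gives the statement on graphs.

  The other properties of the resolvent are thereby properties of minimisers. They rest on two
  facts. A lower semicontinuous function plus a convergent real perturbation respects limits of
  upper bounds (\<open>lsc_add_le_limit\<close>), so that minimisers converge to minimisers even if \<open>x\<close> and
  \<open>lam\<close> vary (\<open>prox_closed_graph\<close>). Below the threshold, the quadratic lower bound on \<open>f\<close> belongs
  to a parameter larger than \<open>lam\<close>, so the objective is coercive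
  (\<open>prox_objective_sublevel_bounded\<close>). Together they make a minimising sequence subconverge to
  a minimiser
  (\<open>prox_nonempty\<close>) and make the set of minimisers closed and bounded.
\<close>

section \<open>Proximal points and level proximal subgradients\<close>

lemma prox_iff:
  "y \<in> prox lam f x \<longleftrightarrow>
    (\<forall>z. f y + ereal (1 / (2 * lam) * (norm (y - x))\<^sup>2)
       \<le> f z + ereal (1 / (2 * lam) * (norm (z - x))\<^sup>2))"
  by (auto simp: prox_def is_arg_min_def not_less)

lemma level_resolvent_iff:
  assumes "lam \<noteq> 0"
  shows "y \<in> level_resolvent lam f x \<longleftrightarrow> (x - y) /\<^sub>R lam \<in> level_prox_subdiff lam f y"
proof -
  have "x = y + lam *\<^sub>R u \<longleftrightarrow> u = (x - y) /\<^sub>R lam" for u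
    using assms by (auto simp del: scaleR_right_diff_distrib simp: scaleR_right_diff_distrib[symmetric])
  then show ?thesis
    by (auto simp: level_resolvent_def op_inverse_def id_plus_def)
qed

lemma prox_quadratic_expand:
  fixes x y z :: "'a::real_inner"
  assumes "lam \<noteq> 0"
  shows "1 / (2 * lam) * (norm (y - x))\<^sup>2 - 1 / (2 * lam) * (norm (z - x))\<^sup>2
       = ((x - y) /\<^sub>R lam) \<bullet> (z - y) - 1 / (2 * lam) * (norm (z - y))\<^sup>2"
proof -
  have "(norm (z - x))\<^sup>2 = (norm (y - x))\<^sup>2 - 2 * ((x - y) \<bullet> (z - y)) + (norm (z - y))\<^sup>2"
    by (simp add: power2_norm_eq_inner inner_diff_left inner_diff_right inner_commute)
  then show ?thesis using assms unfolding inner_scaleR_left by (simp add: field_simps)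
qed

text \<open>
  Properness enters because the subdifferential is empty off the effective domain: a minimiser has
  a finite value as soon as some point has one.
\<close>

lemma prox_eq_level_resolvent:
  fixes f :: "'a::real_inner \<Rightarrow> ereal"
  assumes f: "proper f" and lam: "lam \<noteq> 0"
  shows "prox lam f x = level_resolvent lam f x"
proof (rule set_eqI)
  fix y
  let ?q = "\<lambda>z. 1 / (2 * lam) * (norm (z - x))\<^sup>2"
  let ?u = "(x - y) /\<^sub>R lam"
  obtain w where w: "f w < \<infinity>" using f by (auto simp: proper_def eff_dom_def)
  have dom: "f y < \<infinity>" if "f y + ereal (?q y) \<le> f w + ereal (?q w)"
    using that w by (cases "f y"; cases "f w") auto
  have "f y + ereal (?q y) \<le> f z + ereal (?q z) \<longleftrightarrow>
      f z \<ge> f y + ereal (?u \<bullet> (z - y)) - ereal (1 / (2 * lam) * (norm (z - y))\<^sup>2)"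
    for z
    using f prox_quadratic_expand[OF lam, of y x z]
    by (cases "f y"; cases "f z") (auto simp: proper_def simp del: times_divide_eq_left)
  then have "?u \<in> level_prox_subdiff lam f y \<longleftrightarrow> f y < \<infinity> \<and> y \<in> prox lam f x"
    by (simp add: prox_iff level_prox_subdiff_def eff_dom_def)
  moreover have "f y < \<infinity>" if "y \<in> prox lam f x"
    using that dom unfolding prox_iff by blast
  ultimately show "y \<in> prox lam f x \<longleftrightarrow> y \<in> level_resolvent lam f x"
    unfolding level_resolvent_iff[OF lam] by blast
qed

section \<open>Limits of proximal points\<close>

text \<open>
  This is the sequential form of lower semicontinuity, with the quadratic term of the proximal
  objective carried along as the perturbation \<open>q\<close>.
\<close>

lemma lsc_add_le_limit:
  fixes f :: "'a::topological_space \<Rightarrow> ereal" and V :: "nat \<Rightarrow> 'a"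
  assumes f: "lsc f" and V: "V \<longlonglongrightarrow> v" and q: "q \<longlonglongrightarrow> q0" and b: "b \<longlonglongrightarrow> b0"
    and le: "\<And>k. f (V k) + ereal (q k) \<le> b k"
  shows "f v + ereal q0 \<le> b0"
proof (rule dense_le)
  fix y assume "y < f v + ereal q0"
  then have "y - ereal q0 < f v" by (simp add: ereal_minus_less_iff)
  then obtain t where t: "y - ereal q0 < t" "t < f v" using dense by blast
  have "t < Liminf (at v) f"
    using f t(2) by (auto simp: lsc_def intro: less_le_trans)
  then have "\<forall>\<^sub>F x in at v. t < f x" by (rule less_LiminfD)
  then have "\<forall>\<^sub>F x in nhds v. t < f x"
    using t(2) by (auto simp: eventually_at_filter elim: eventually_mono)
  then have "\<forall>\<^sub>F k in sequentially. t < f (V k)"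
    using V by (rule eventually_compose_filterlim)
  then have bound: "\<forall>\<^sub>F k in sequentially. t + ereal (q k) \<le> b k"
  proof eventually_elim
    case (elim k)
    then have "t + ereal (q k) \<le> f (V k) + ereal (q k)" by (intro add_right_mono) simp
    also have "\<dots> \<le> b k" by (rule le)
    finally show ?case .
  qed
  have "(\<lambda>k. t + ereal (q k)) \<longlonglongrightarrow> t + ereal q0"
    using q by (intro tendsto_add_ereal_general) auto
  with b bound have "t + ereal q0 \<le> b0" by (intro tendsto_le) auto
  moreover have "y \<le> t + ereal q0" using t(1) by (cases y; cases t) auto
  ultimately show "y \<le> b0" by simp
qed

lemma prox_closed_graph:
  fixes f :: "'a::real_normed_vector \<Rightarrow> ereal"
  assumes f: "lsc f" and lam: "lam \<noteq> 0"
    and X: "X \<longlonglongrightarrow> x" and L: "L \<longlonglongrightarrow> lam" and V: "V \<longlonglongrightarrow> v"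
    and mem: "\<And>k. V k \<in> prox (L k) f (X k)"
  shows "v \<in> prox lam f x"
  unfolding prox_iff
proof
  fix z
  let ?q = "\<lambda>w k. 1 / (2 * L k) * (norm (w - X k))\<^sup>2"
  show "f v + ereal (1 / (2 * lam) * (norm (v - x))\<^sup>2)
      \<le> f z + ereal (1 / (2 * lam) * (norm (z - x))\<^sup>2)"
  proof (rule lsc_add_le_limit[OF f V, where q = "\<lambda>k. ?q (V k) k" and b = "\<lambda>k. f z + ereal (?q z k)"])
    show "(\<lambda>k. ?q (V k) k) \<longlonglongrightarrow> 1 / (2 * lam) * (norm (v - x))\<^sup>2"
      using lam by (intro tendsto_intros X L V) auto
    have "?q z \<longlonglongrightarrow> 1 / (2 * lam) * (norm (z - x))\<^sup>2"
      using lam by (intro tendsto_intros X L) auto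
    then show "(\<lambda>k. f z + ereal (?q z k)) \<longlonglongrightarrow> f z + ereal (1 / (2 * lam) * (norm (z - x))\<^sup>2)"
      by (intro tendsto_add_ereal_general) auto
    show "f (V k) + ereal (?q (V k) k) \<le> f z + ereal (?q z k)" for k
      using mem[of k] unfolding prox_iff by blast
  qed
qed

section \<open>Coercivity below the threshold\<close>

text \<open>
  The lower bound \<open>c - \<parallel>z\<parallel>\<^sup>2 / (2 mu)\<close> on \<open>f\<close> loses against \<open>\<parallel>z - x\<parallel>\<^sup>2 / (2 lam)\<close> because
  \<open>lam < mu\<close> leaves a positive coefficient in front of \<open>\<parallel>z\<parallel>\<^sup>2\<close>.
\<close>

lemma prox_objective_sublevel_bounded:
  fixes f :: "'a::real_normed_vector \<Rightarrow> ereal"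
  assumes pb: "prox_bounded_with mu f" and lam: "0 < lam" "lam < mu"
  shows "bounded {z. f z + ereal (1 / (2 * lam) * (norm (z - x))\<^sup>2) \<le> ereal a}"
proof -
  define p where "p = 1 / (2 * lam)"
  define q where "q = 1 / (2 * mu)"
  have p: "0 < p" and qp: "0 < p - q"
    using lam by (auto simp: p_def q_def field_simps)
  obtain c where c: "\<And>z. ereal c \<le> f z + ereal (q * (norm z)\<^sup>2)"
    using pb unfolding prox_bounded_with_def q_def by blast
  define B where "B = \<bar>a - c\<bar> + 2 * p * norm x"
  have "norm z \<le> max 1 (B / (p - q))"
    if z: "f z + ereal (p * (norm (z - x))\<^sup>2) \<le> ereal a" for z
  proof (cases "norm z \<le> 1")
    case False
    then have r: "1 < norm z" by simp
    (* B absorbs the terms of order at most one, since 1 < norm z; dividing by norm z then bounds it. *)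
    have "c + p * (norm (z - x))\<^sup>2 \<le> a + q * (norm z)\<^sup>2"
      using z c[of z] by (cases "f z") auto
    moreover have "p * ((norm z)\<^sup>2 - 2 * norm z * norm x) \<le> p * (norm (z - x))\<^sup>2"
    proof -
      have "(norm z - norm x)\<^sup>2 \<le> (norm (z - x))\<^sup>2"
        using norm_triangle_ineq3[of z x] abs_le_square_iff[of "norm z - norm x" "norm (z - x)"] by simp
      moreover have "(norm z)\<^sup>2 - 2 * norm z * norm x \<le> (norm z - norm x)\<^sup>2"
        by (simp add: power2_diff)
      ultimately show ?thesis using p by (intro mult_left_mono) auto
    qed
    moreover have "\<bar>a - c\<bar> \<le> \<bar>a - c\<bar> * norm z"
      using r mult_left_mono[of 1 "norm z" "\<bar>a - c\<bar>"] by simp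
    ultimately have "(p - q) * norm z * norm z \<le> B * norm z"
      by (simp add: B_def algebra_simps power2_eq_square)
    then have "(p - q) * norm z \<le> B"
      using r mult_right_le_imp_le[of "(p - q) * norm z" "norm z" B] by linarith
    then have "norm z \<le> B / (p - q)" using qp by (simp add: field_simps)
    then show ?thesis by simp
  qed simp
  then show ?thesis unfolding bounded_iff p_def by blast
qed

lemma prox_nonempty:
  fixes f :: "'a::euclidean_space \<Rightarrow> ereal"
  assumes f: "proper f" "lsc f"
    and pb: "prox_bounded_with mu f" and lam: "0 < lam" "lam < mu"
  shows "prox lam f x \<noteq> {}"
proof -
  let ?q = "\<lambda>z. 1 / (2 * lam) * (norm (z - x))\<^sup>2"
  let ?g = "\<lambda>z. f z + ereal (?q z)"
  let ?m = "Inf (range ?g)"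
  obtain w where w: "f w < \<infinity>" using f by (auto simp: proper_def eff_dom_def)
  have "?m \<le> ?g w" by (rule Inf_lower) simp
  also have "\<dots> < \<infinity>" using w by (cases "f w") auto
  finally obtain a where a: "?m < ereal a" using ereal_dense2 by blast
  obtain u where u: "\<And>n. u n \<in> range ?g" "u \<longlonglongrightarrow> ?m"
    using Inf_as_limit[of "range ?g"] by auto
  have "\<forall>n. \<exists>z. u n = ?g z" using u(1) by blast
  then obtain Z where Z: "\<And>n. u n = ?g (Z n)"
    unfolding choice_iff by blast
  (* Only a tail of the minimising sequence need lie in the bounded sublevel set for a. *)
  obtain N where N: "\<And>n. n \<ge> N \<Longrightarrow> u n < ereal a"
    using order_tendstoD(2)[OF u(2) a] by (auto simp: eventually_sequentially)
  have "range (\<lambda>n. Z (n + N)) \<subseteq> {z. ?g z \<le> ereal a}"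
    using N Z by (auto intro: less_imp_le)
  then have "bounded (range (\<lambda>n. Z (n + N)))"
    using prox_objective_sublevel_bounded[OF pb lam] bounded_subset by blast
  then obtain z r where r: "strict_mono r" and z: "((\<lambda>n. Z (n + N)) \<circ> r) \<longlonglongrightarrow> z"
    using bounded_imp_convergent_subsequence by blast
  let ?Z = "\<lambda>k. Z (r k + N)"
  have lim: "?Z \<longlonglongrightarrow> z" using z by (simp add: o_def)
  have "?g z \<le> ?m"
  proof (rule lsc_add_le_limit[OF f(2) lim])
    show "(\<lambda>k. ?q (?Z k)) \<longlonglongrightarrow> ?q z"
      by (intro tendsto_intros lim)
    show "(\<lambda>k. u (r k + N)) \<longlonglongrightarrow> ?m"
      using LIMSEQ_subseq_LIMSEQ[OF LIMSEQ_ignore_initial_segment[OF u(2), of N] r]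
      by (simp add: o_def)
    show "f (?Z k) + ereal (?q (?Z k)) \<le> u (r k + N)" for k
      by (simp only: Z order_refl)
  qed
  then have "?g z \<le> ?g y" for y
    by (rule order_trans) (rule Inf_lower, simp)
  then have "z \<in> prox lam f x" unfolding prox_iff by blast
  then show ?thesis by blast
qed

lemma prox_compact:
  fixes f :: "'a::euclidean_space \<Rightarrow> ereal"
  assumes f: "proper f" "lsc f"
    and pb: "prox_bounded_with mu f" and lam: "0 < lam" "lam < mu"
  shows "compact (prox lam f x)"
proof -
  let ?g = "\<lambda>z. f z + ereal (1 / (2 * lam) * (norm (z - x))\<^sup>2)"
  obtain w where w: "f w < \<infinity>" "f w > -\<infinity>" using f by (auto simp: proper_def eff_dom_def)
  then obtain a where a: "?g w = ereal a" by (cases "f w") auto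
  have "prox lam f x \<subseteq> {z. ?g z \<le> ereal a}"
    unfolding prox_iff subset_iff mem_Collect_eq a[symmetric] by blast
  then have "bounded (prox lam f x)"
    using prox_objective_sublevel_bounded[OF pb lam] bounded_subset by blast
  moreover have "closed (prox lam f x)"
    unfolding closed_sequential_limits
    using prox_closed_graph[OF f(2), of lam "\<lambda>_. x" x "\<lambda>_. lam"] lam by auto
  ultimately show ?thesis by (simp add: compact_eq_bounded_closed)
qed

section \<open>The resolvent and the graph of the subdifferential\<close>

lemma linear_prox_transform: "linear (prox_transform lam)"
  by (rule linearI) (auto simp: prox_transform_def algebra_simps)

lemma bij_prox_transform:
  assumes "lam \<noteq> 0"
  shows "bij (prox_transform lam)"
  using assms
  by (intro o_bij[where g = "\<lambda>(y, u). (y + lam *\<^sub>R u, y)"])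
    (auto simp: prox_transform_def o_def fun_eq_iff)

lemma gph_level_prox_subdiff:
  assumes "lam \<noteq> 0"
  shows "gph (level_prox_subdiff lam f) = prox_transform lam ` gph (level_resolvent lam f)"
proof (intro equalityI subsetI)
  fix p assume p: "p \<in> gph (level_prox_subdiff lam f)"
  obtain y u where yu: "p = (y, u)" by fastforce
  have "p = prox_transform lam (y + lam *\<^sub>R u, y)"
    using assms yu by (simp add: prox_transform_def)
  moreover have "(y + lam *\<^sub>R u, y) \<in> gph (level_resolvent lam f)"
    using p yu assms by (simp add: gph_def level_resolvent_iff)
  ultimately show "p \<in> prox_transform lam ` gph (level_resolvent lam f)" by blast
qed (use assms in \<open>auto simp: gph_def prox_transform_def level_resolvent_iff\<close>)

theorem theorem3p7:
  fixes f :: "'a::euclidean_space \<Rightarrow> ereal" and lam :: real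
  assumes "proper f" and "lsc f" and "prox_bounded f"
    and "0 < lam" and "ereal lam < prox_threshold f"
  shows "prox lam f = level_resolvent lam f
    \<and> op_dom (level_resolvent lam f) = UNIV
    \<and> (\<forall>x. compact (level_resolvent lam f x))
    \<and> (\<forall>x. level_resolvent lam f x =
          {v. \<exists>(X :: nat \<Rightarrow> 'a) (L :: nat \<Rightarrow> real) (V :: nat \<Rightarrow> 'a).
                X \<longlonglongrightarrow> x \<and> L \<longlonglongrightarrow> lam \<and> (\<forall>k. L k > 0)
                \<and> (\<forall>k. V k \<in> level_resolvent (L k) f (X k)) \<and> V \<longlonglongrightarrow> v})
    \<and> gph (level_prox_subdiff lam f) = prox_transform lam ` gph (prox lam f)
    \<and> linear (prox_transform lam :: 'a \<times> 'a \<Rightarrow> 'a \<times> 'a)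
    \<and> bij (prox_transform lam :: 'a \<times> 'a \<Rightarrow> 'a \<times> 'a)"
proof -
  have lam: "lam \<noteq> 0" using assms(4) by simp
  obtain mu where mu: "lam < mu" "prox_bounded_with mu f"
    using assms(5) by (auto simp: prox_threshold_def less_Sup_iff)
  have eq: "prox l f x = level_resolvent l f x" if "l > 0" for l x
    using prox_eq_level_resolvent[OF assms(1)] that by auto
  have res: "prox lam f = level_resolvent lam f"
    using eq assms(4) by blast
  have "op_dom (level_resolvent lam f) = UNIV"
    using prox_nonempty[OF assms(1,2) mu(2) assms(4) mu(1)] by (auto simp: op_dom_def res)
  moreover have "compact (level_resolvent lam f x)" for x
    using prox_compact[OF assms(1,2) mu(2) assms(4) mu(1)] by (simp add: res)
  moreover have "level_resolvent lam f x =
      {v. \<exists>(X :: nat \<Rightarrow> 'a) (L :: nat \<Rightarrow> real) (V :: nat \<Rightarrow> 'a).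
        X \<longlonglongrightarrow> x \<and> L \<longlonglongrightarrow> lam \<and> (\<forall>k. L k > 0)
        \<and> (\<forall>k. V k \<in> level_resolvent (L k) f (X k)) \<and> V \<longlonglongrightarrow> v}" (is "_ = ?R") for x
  proof (intro equalityI subsetI)
    fix v assume "v \<in> level_resolvent lam f x"
    then show "v \<in> ?R"
      using assms(4)
      by (intro CollectI exI[of _ "\<lambda>_. x"] exI[of _ "\<lambda>_. lam"] exI[of _ "\<lambda>_. v"]) simp
  next
    fix v assume "v \<in> ?R"
    then obtain X L V where lims: "X \<longlonglongrightarrow> x" "L \<longlonglongrightarrow> lam" "V \<longlonglongrightarrow> v"
      and pos: "\<And>k. L k > 0" and mem: "\<And>k. V k \<in> level_resolvent (L k) f (X k)"
      by blast
    have "V k \<in> prox (L k) f (X k)" for k using mem pos eq by blast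
    then show "v \<in> level_resolvent lam f x"
      using prox_closed_graph[OF assms(2) lam lims] by (simp add: res)
  qed
  ultimately show ?thesis
    using gph_level_prox_subdiff[OF lam, of f] linear_prox_transform bij_prox_transform[OF lam]
    unfolding res by blast
qed

end
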